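(* Let $A \in \mathbb{R}^{m \times n}$ satisfy $\mathrm{rank}(A) = k \le \min\{m, n\}$, and let $X \in \mathbb{R}^{n \times (n-1)}$ have full column rank. Let $S \subset \{1, \dots, n\}$, $|S| = k$, be a subset of $k$ column indices such that $\mathrm{col}(A_{:,S}) = \mathrm{col}(A)$. Suppose that there exists $v \in \mathbb{R}^n$ satisfying $v^\top X = 0$ for which there exists $i \in S$ such that $v_i \ne 0$, and $v \notin \mathrm{row}(A)$. Then there exists a matrix $B \in \mathbb{R}^{m \times n}$ with $\mathrm{rank}(B) = k$ such that $BX = AX$, but $\mathrm{col}(B_{:,S}) \ne \mathrm{col}(B)$.
   Context: $A_{:,S}$ denotes the submatrix of $A$ consisting of the columns indexed by $S$; $\mathrm{col}(\cdot)$ and $\mathrm{row}(\cdot)$ denote the column space and row space of a matrix (the row space viewed as a subspace of $\mathbb{R}^n$); $v_i$ is the $i$th entry of $v$. *)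

theory Defs
  imports Complex_Main "Jordan_Normal_Form.DL_Rank_Submatrix"
begin

end

theory Submission
  imports Defs
begin

text \<open>Choose \<open>i \<in> S\<close> with \<open>v\<^sub>i \<noteq> 0\<close> and let \<open>B = A - (1/v\<^sub>i) a\<^sub>i v\<^sup>T\<close>, where \<open>a\<^sub>i\<close> is column \<open>i\<close> of \<open>A\<close>.
  Since \<open>v\<^sup>T X = 0\<close>, \<open>B X = A X\<close>. As \<open>v\<close> is not in the row space of \<open>A\<close>, there is \<open>w \<in> ker A\<close> with
  \<open>v \<bullet> w \<noteq> 0\<close>; hence every \<open>A x\<close> equals \<open>A x'\<close> for some \<open>x'\<close> orthogonal to \<open>v\<close>, and \<open>A x' = B x'\<close>.
  So \<open>A\<close> and \<open>B\<close> have the same column space, but column \<open>i\<close> of \<open>B\<close> vanishes, so the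
  \<open>k\<close> columns of \<open>B\<close> indexed by \<open>S\<close> span a space of dimension less than \<open>k\<close>.\<close>

text \<open>Induction on \<open>W\<close>, which needs no positivity of the scalar product and so
  works over any field. If some \<open>u\<close> annihilates \<open>W\<close> but not
  \<open>a\<close>, a vector separating \<open>v - c a\<close> from \<open>W\<close> can be
  corrected along \<open>u\<close> until it annihilates \<open>a\<close> as well.\<close>

lemma (in vec_space) not_in_span_separating_vec:
  assumes "finite W" "W \<subseteq> carrier_vec n" "v \<in> carrier_vec n" "v \<notin> span W"
  shows "\<exists>w\<in>carrier_vec n. (\<forall>x\<in>W. x \<bullet> w = 0) \<and> v \<bullet> w \<noteq> 0"
  using assms
proof (induction W arbitrary: v rule: finite_induct)
  case empty
  then have "v \<noteq> 0\<^sub>v n" using span_empty by auto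
  then obtain i where i: "i < n" "v $ i \<noteq> 0"
    using \<open>v \<in> carrier_vec n\<close> by (metis carrier_vecD eq_vecI index_zero_vec)
  then have "v \<bullet> unit_vec n i \<noteq> 0" using empty.prems by simp
  then show ?case by (intro bexI[of _ "unit_vec n i"]) auto
next
  case (insert a W)
  then have a: "a \<in> carrier_vec n" and W: "W \<subseteq> carrier_vec n" by auto
  note v = \<open>v \<in> carrier_vec n\<close>
  show ?case
  proof (cases "\<exists>u\<in>carrier_vec n. (\<forall>x\<in>W. x \<bullet> u = 0) \<and> a \<bullet> u \<noteq> 0")
    case True
    then obtain u where u: "u \<in> carrier_vec n" "\<And>x. x \<in> W \<Longrightarrow> x \<bullet> u = 0" "a \<bullet> u \<noteq> 0" by blast
    \<comment> \<open>This \<open>c\<close> makes \<open>v - c a\<close> orthogonal to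
      \<open>u\<close>, so a later shift along \<open>u\<close> leaves the product with
      \<open>v - c a\<close> unchanged.\<close>
    define c where "c = (v \<bullet> u) / (a \<bullet> u)"
    have vc: "v - c \<cdot>\<^sub>v a \<in> carrier_vec n" using v a by simp
    have "v - c \<cdot>\<^sub>v a \<notin> span W"
    proof
      assume "v - c \<cdot>\<^sub>v a \<in> span W"
      then have "v - c \<cdot>\<^sub>v a \<in> span (insert a W)" using span_is_monotone[OF subset_insertI] by blast
      moreover have "c \<cdot>\<^sub>v a \<in> span (insert a W)"
        using smult_in_span[OF insert.prems(1)] in_own_span[of "insert a W"] insert.prems(1) by auto
      ultimately have "(v - c \<cdot>\<^sub>v a) + c \<cdot>\<^sub>v a \<in> span (insert a W)"
        using span_add1[of "insert a W"] insert.prems(1) by auto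
      moreover have "(v - c \<cdot>\<^sub>v a) + c \<cdot>\<^sub>v a = v" using v a by auto
      ultimately show False using insert.prems(3) by simp
    qed
    from insert.IH[OF W vc this] obtain w where
      w: "w \<in> carrier_vec n" "\<And>x. x \<in> W \<Longrightarrow> x \<bullet> w = 0" "(v - c \<cdot>\<^sub>v a) \<bullet> w \<noteq> 0" by blast
    \<comment> \<open>The multiple of \<open>u\<close> is chosen so that
      \<open>a \<bullet> z = 0\<close>. Then \<open>v \<bullet> z\<close> equals
      \<open>(v - c a) \<bullet> z\<close>, hence \<open>(v - c a) \<bullet> w\<close>.\<close>
    define d where "d = (a \<bullet> w) / (a \<bullet> u)"
    define z where "z = w - d \<cdot>\<^sub>v u"
    have dot: "x \<bullet> z = x \<bullet> w - d * (x \<bullet> u)" if "x \<in> carrier_vec n" for x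
      using that u(1) w(1) unfolding z_def by (simp add: scalar_prod_minus_distrib)
    have "(v - c \<cdot>\<^sub>v a) \<bullet> w = v \<bullet> w - c * (a \<bullet> w)"
      using v a w(1) by (simp add: minus_scalar_prod_distrib)
    then have "v \<bullet> z = (v - c \<cdot>\<^sub>v a) \<bullet> w" using dot[OF v] by (simp only: c_def d_def) simp
    then have "v \<bullet> z \<noteq> 0" using w(3) by simp
    moreover have "a \<bullet> z = 0" using u(3) dot[OF a] by (simp add: d_def)
    moreover have "x \<bullet> z = 0" if "x \<in> W" for x using that W dot[of x] u(2) w(2) by auto
    moreover have "z \<in> carrier_vec n" using u(1) w(1) unfolding z_def by simp
    ultimately show ?thesis by blast
  next
    \<comment> \<open>Here whatever annihilates \<open>W\<close> annihilates \<open>a\<close> too,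
      so a vector separating \<open>v\<close> from \<open>W\<close> already serves.\<close>
    case False
    have "v \<notin> span W" using insert.prems(3) span_is_monotone[OF subset_insertI] by blast
    from insert.IH[OF W v this] show ?thesis using False by blast
  qed
qed

text \<open>The entries of \<open>A w\<close> are the products of the rows with \<open>w\<close>, so
  a vector separating \<open>v\<close> from the rows lies in the kernel.\<close>

lemma (in vec_space) not_in_row_space_kernel_vec:
  assumes A: "A \<in> carrier_mat m n" and v: "v \<in> carrier_vec n" and "v \<notin> row_space A"
  shows "\<exists>w\<in>carrier_vec n. A *\<^sub>v w = 0\<^sub>v m \<and> v \<bullet> w \<noteq> 0"
proof -
  obtain w where w: "w \<in> carrier_vec n" "\<And>x. x \<in> set (rows A) \<Longrightarrow> x \<bullet> w = 0" "v \<bullet> w \<noteq> 0"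
    using not_in_span_separating_vec[of "set (rows A)" v] assms rows_carrier[of A]
    unfolding row_space_def by auto
  have "A *\<^sub>v w = 0\<^sub>v m"
    using A w(2) by (intro eq_vecI) (auto simp: rows_def)
  with w show ?thesis by blast
qed

text \<open>The rank is the size of a maximal independent set \<open>T\<close> of columns. Such a
  \<open>T\<close> omits the zero vector, so it is a proper subset of the at most \<open>nc\<close>
  distinct columns.\<close>

lemma (in vec_space) rank_lt_dim_col_if_zero_col:
  assumes A: "A \<in> carrier_mat n nc" and j: "j < nc" "col A j = 0\<^sub>v n"
  shows "rank A < nc"
proof -
  obtain T where T: "maximal T (\<lambda>T. T \<subseteq> set (cols A) \<and> lin_indpt T)"
    using maximal_exists_superset[of "set (cols A)" "\<lambda>T. T \<subseteq> set (cols A) \<and> lin_indpt T" "{}"]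
      finite_lin_indpt2[of "{}"] by auto
  then have sub: "T \<subseteq> set (cols A)" and li: "lin_indpt T" unfolding maximal_def by auto
  have carr: "T \<subseteq> carrier_vec n" using sub cols_dim[of A] A by auto
  have "0\<^sub>v n \<notin> T" using vs_zero_lin_dep[OF _ li] carr by auto
  moreover have "0\<^sub>v n \<in> set (cols A)" using A j by (auto simp: cols_def intro!: image_eqI[of _ _ j])
  ultimately have "T \<subset> set (cols A)" using sub by auto
  then have "card T < card (set (cols A))" by (intro psubset_card_mono) auto
  also have "\<dots> \<le> nc" using A card_length[of "cols A"] by simp
  finally show ?thesis using rank_card_indpt[OF A T] by simp
qed

lemma (in vec_space) rank_eq_if_col_space_eq:
  "col_space A = col_space B \<Longrightarrow> rank A = rank B"
  unfolding rank_def col_space_def by simp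

lemma rank_one_update_mult_vec:
  fixes A :: "'a :: comm_ring_1 mat"
  assumes "A \<in> carrier_mat m n" "u \<in> carrier_vec m" "v \<in> carrier_vec n" "x \<in> carrier_vec n"
  shows "(A + mat m n (\<lambda>(r, c). u $ r * v $ c)) *\<^sub>v x = A *\<^sub>v x + (v \<bullet> x) \<cdot>\<^sub>v u"
proof (rule eq_vecI)
  fix r assume "r < dim_vec (A *\<^sub>v x + (v \<bullet> x) \<cdot>\<^sub>v u)"
  then have "r < m" using assms by simp
  with assms show "((A + mat m n (\<lambda>(r, c). u $ r * v $ c)) *\<^sub>v x) $ r = (A *\<^sub>v x + (v \<bullet> x) \<cdot>\<^sub>v u) $ r"
    by (simp add: scalar_prod_def algebra_simps sum.distrib sum_distrib_left)
qed (use assms in simp)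

text \<open>\<open>submatrix\<close> renumbers the columns it keeps: \<open>j\<close> moves to the
  position given by the number of elements of \<open>J\<close> below it, and \<open>pick J\<close>
  inverts this count.\<close>

lemma col_submatrix_UNIV_index_card:
  assumes "j < dim_col A" "j \<in> J"
  shows "card {a \<in> J. a < j} < dim_col (submatrix A UNIV J)"
    and "col (submatrix A UNIV J) (card {a \<in> J. a < j}) = col A j"
proof -
  have "{a \<in> J. a < j} \<subset> {a. a < dim_col A \<and> a \<in> J}" using assms by auto
  then show lt: "card {a \<in> J. a < j} < dim_col (submatrix A UNIV J)"
    unfolding dim_submatrix by (intro psubset_card_mono) auto
  show "col (submatrix A UNIV J) (card {a \<in> J. a < j}) = col A j"
    using lt assms pick_card_in_set[of j J]
    by (intro eq_vecI) (auto simp: submatrix_index pick_UNIV dim_submatrix)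
qed

theorem proposition5p2:
  fixes A X :: "real mat" and m n k :: nat and S :: "nat set"
  assumes "A \<in> carrier_mat m n"
    and "vec_space.rank m A = k"
    and "k \<le> min m n"
    and "X \<in> carrier_mat n (n - 1)"
    and "vec_space.rank n X = n - 1"
    and "S \<subseteq> {0..<n}"
    and "card S = k"
    and "vec_space.col_space m (submatrix A UNIV S) = vec_space.col_space m A"
    and "\<exists>v \<in> carrier_vec n. mat_of_row v * X = 0\<^sub>m 1 (n - 1)
           \<and> (\<exists>i \<in> S. v $ i \<noteq> 0) \<and> v \<notin> vec_space.row_space n A"
  shows "\<exists>B \<in> carrier_mat m n. vec_space.rank m B = k \<and> B * X = A * X
           \<and> vec_space.col_space m (submatrix B UNIV S) \<noteq> vec_space.col_space m B"
proof -
  interpret M: vec_space "TYPE(real)" m .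
  interpret N: vec_space "TYPE(real)" n .
  note A = assms(1) and X = assms(4)
  obtain v i where v: "v \<in> carrier_vec n" and vX: "mat_of_row v * X = 0\<^sub>m 1 (n - 1)"
    and i: "i \<in> S" "v $ i \<noteq> 0" and "v \<notin> N.row_space A"
    using assms(9) by blast
  then obtain w where w: "w \<in> carrier_vec n" "A *\<^sub>v w = 0\<^sub>v m" "v \<bullet> w \<noteq> 0"
    using N.not_in_row_space_kernel_vec[OF A] by blast
  have i_n: "i < n" using i assms(6) by auto
  \<comment> \<open>The factor is chosen so that \<open>v $ i\<close> times \<open>u\<close> cancels
    column \<open>i\<close> of \<open>A\<close>.\<close>
  define u where "u = (- 1 / v $ i) \<cdot>\<^sub>v col A i"
  define B where "B = A + mat m n (\<lambda>(r, c). u $ r * v $ c)"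
  have u: "u \<in> carrier_vec m" and B: "B \<in> carrier_mat m n" using A by (auto simp: u_def B_def)
  have Bx: "B *\<^sub>v x = A *\<^sub>v x + (v \<bullet> x) \<cdot>\<^sub>v u" if "x \<in> carrier_vec n" for x
    unfolding B_def using rank_one_update_mult_vec[OF A u v that] .
  have Bx_orth: "B *\<^sub>v x = A *\<^sub>v x" if "x \<in> carrier_vec n" "v \<bullet> x = 0" for x
    using Bx[OF that(1)] that A u by auto
  have "v \<bullet> col X j = 0" if "j < n - 1" for j
  proof -
    have "(mat_of_row v * X) $$ (0, j) = 0" using vX that by simp
    then show ?thesis using that X v by simp
  qed
  then have BXj: "B *\<^sub>v col X j = A *\<^sub>v col X j" if "j < n - 1" for j
    using Bx_orth[of "col X j"] X that by auto
  have BX: "B * X = A * X"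
  proof (rule mat_col_eqI)
    fix j assume "j < dim_col (A * X)"
    then show "col (B * X) j = col (A * X) j"
      using BXj[of j] X col_mult2[OF A X] col_mult2[OF B X] by simp
  qed (use A B X in auto)
  have "M.col_space B = M.col_space A"
  proof (intro equalityI subsetI)
    fix y assume "y \<in> M.col_space B"
    then obtain x where x: "x \<in> carrier_vec n" "y = B *\<^sub>v x" using M.col_space_eq[OF B] B by auto
    \<comment> \<open>Since \<open>u\<close> is a multiple of column \<open>i\<close> of
      \<open>A\<close>, the correction term in \<open>B x\<close> is absorbed by moving
      \<open>x\<close> along the unit vector \<open>i\<close>.\<close>
    define z where "z = x - (v \<bullet> x / v $ i) \<cdot>\<^sub>v unit_vec n i"
    have z: "z \<in> carrier_vec n" using x(1) by (simp add: z_def)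
    have "A *\<^sub>v z = A *\<^sub>v x - (v \<bullet> x / v $ i) \<cdot>\<^sub>v (A *\<^sub>v unit_vec n i)"
      using A x(1) by (simp add: z_def mult_minus_distrib_mat_vec mult_mat_vec)
    also have "A *\<^sub>v unit_vec n i = col A i"
      using A i_n by (intro eq_vecI) auto
    also have "A *\<^sub>v x - (v \<bullet> x / v $ i) \<cdot>\<^sub>v col A i = A *\<^sub>v x + (v \<bullet> x) \<cdot>\<^sub>v u"
      using A by (intro eq_vecI) (simp_all add: u_def)
    finally have "A *\<^sub>v z = y" using x(2) Bx[OF x(1)] by simp
    moreover have "y \<in> carrier_vec (dim_row A)" using x B A by auto
    ultimately show "y \<in> M.col_space A" unfolding M.col_space_eq[OF A] using A z by auto
  next
    fix y assume "y \<in> M.col_space A"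
    then obtain x where x: "x \<in> carrier_vec n" "y = A *\<^sub>v x" using M.col_space_eq[OF A] A by auto
    \<comment> \<open>Moving \<open>x\<close> along the kernel vector \<open>w\<close> keeps
      \<open>A x\<close> fixed and reaches the hyperplane orthogonal to \<open>v\<close>, where
      \<open>A\<close> and \<open>B\<close> agree.\<close>
    define z where "z = x - (v \<bullet> x / (v \<bullet> w)) \<cdot>\<^sub>v w"
    have z: "z \<in> carrier_vec n" using x w by (simp add: z_def)
    have "v \<bullet> z = 0" using v x w by (simp add: z_def scalar_prod_minus_distrib)
    moreover have "A *\<^sub>v z = y"
      using A x w by (simp add: z_def mult_minus_distrib_mat_vec mult_mat_vec)
    ultimately have "B *\<^sub>v z = y" using Bx_orth z by simp
    then show "y \<in> M.col_space B" unfolding M.col_space_eq[OF B] using A B x z by auto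
  qed
  then have rankB: "M.rank B = k" using M.rank_eq_if_col_space_eq[of B A] assms(2) by simp
  have colB: "col B i = 0\<^sub>v m"
    using A B i i_n by (intro eq_vecI) (auto simp: B_def u_def)
  have "{a. a < n \<and> a \<in> S} = S" using assms(6) by auto
  then have BS: "submatrix B UNIV S \<in> carrier_mat m k"
    using B assms(7) by (intro carrier_matI) (simp_all add: dim_submatrix)
  \<comment> \<open>The zero column \<open>i\<close> of \<open>B\<close> survives in the submatrix
    because \<open>i \<in> S\<close>; the cardinality is its new position. Equal column spaces would
    then contradict \<open>rankB\<close>.\<close>
  have "M.rank (submatrix B UNIV S) < k"
    using col_submatrix_UNIV_index_card[of i B S] BS B i i_n colB
    by (intro M.rank_lt_dim_col_if_zero_col[OF BS, of "card {a \<in> S. a < i}"]) auto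
  then have "M.col_space (submatrix B UNIV S) \<noteq> M.col_space B"
    using M.rank_eq_if_col_space_eq[of "submatrix B UNIV S" B] rankB by auto
  then show ?thesis using B rankB BX by blast
qed

end
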